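(* Let $(X,d)$ be an infinite ultrametric space. Then the following statements are equivalent: (i) $(X,d)$ is a compact $\mathbf{US}$-space. (ii) $(X,d)$ is the completion of a totally bounded proper subspace $X_0\subsetneq X$ (with the restricted ultrametric) that is generated by a labeled ray with decreasing labeling.
   Context: Let $\mathbb{R}^+=[0,\infty)$. An ultrametric on a nonempty set $X$ is a symmetric function $d\colon X\times X\to\mathbb{R}^+$ with $d(x,y)=0$ iff $x=y$ and $d(x,y)\le\max\{d(x,z),d(z,y)\}$ for all $x,y,z\in X$. An ultrametric space $(Y,\rho)$ is a completion of an ultrametric space $(X,d)$ if $(Y,\rho)$ is complete and $(X,d)$ is isometric to a dense subspace of $(Y,\rho)$. A subset $A$ of an ultrametric space $(X,d)$ is totally bounded if for every $r>0$ it is covered by finitely many open balls of radius $r$ with centers in $X$. A tree $T$ (finite or infinite, connected simple graph without cycles, with nonempty vertex set) is a star graph with center $c\in V(T)$ if $c$ is adjacent to every other vertex and no two vertices different from $c$ are adjacent. A ray $R=(x_1,x_2,\ldots,x_n,\ldots)$ is the infinite tree with $V(R)=\{x_1,x_2,\ldots\}$ (all $x_n$ distinct) and $E(R)=\{\{x_n,x_{n+1}\}:n\in\mathbb{N}\}$. A labeled tree $T(l)$ is a tree $T$ with a labeling $l\colon V(T)\to\mathbb{R}^+$. For a labeled tree define $d_l(u,u)=0$ and, for $u\neq v$, $d_l(u,v)=\max_{w\in V(P)} l(w)$, where $P$ is the path joining $u$ and $v$ in $T$ (endpoints included). An ultrametric space $(X,d)$ is generated by $T(l)$ if $X=V(T)$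 and $d=d_l$. An ultrametric space is a $\mathbf{US}$-space if it is generated by some labeled star graph. A labeling $l^*\colon V(R)\to\mathbb{R}^+$ of a ray $R=(x_1,x_2,\ldots)$ is decreasing if the sequence $(l^*(x_n))_{n\in\mathbb{N}}$ is decreasing, in the non-strict sense $l^*(x_n)\ge l^*(x_{n+1})$ for all $n$. *)

theory Defs
  imports "HOL-Analysis.Analysis"
begin

section \<open>Ultrametric spaces\<close>

text \<open>
  As in \<^locale>\<open>Metric_space\<close>, the distance is a total function on the ambient type; nonnegativity
  and symmetry are required on the whole type, which only fixes junk values outside the carrier.
\<close>

locale Ultrametric_space =
  fixes X :: "'a set" and d :: "'a \<Rightarrow> 'a \<Rightarrow> real"
  assumes nonempty: "X \<noteq> {}"
    and nonneg: "\<And>x y. 0 \<le> d x y"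
    and commute: "\<And>x y. d x y = d y x"
    and zero: "\<And>x y. \<lbrakk>x \<in> X; y \<in> X\<rbrakk> \<Longrightarrow> d x y = 0 \<longleftrightarrow> x = y"
    and ultra: "\<And>x y z. \<lbrakk>x \<in> X; y \<in> X; z \<in> X\<rbrakk> \<Longrightarrow> d x y \<le> max (d x z) (d z y)"

sublocale Ultrametric_space \<subseteq> Metric_space X d
proof
  fix x y z assume "x \<in> X" "y \<in> X" "z \<in> X"
  then have "d x z \<le> max (d x y) (d y z)" by (intro ultra)
  also have "\<dots> \<le> d x y + d y z" using nonneg[of x y] nonneg[of y z] by simp
  finally show "d x z \<le> d x y + d y z" .
qed (use nonneg commute zero in auto)

text \<open>The library takes the centers of the covering balls in the covered set; it is equivalent
  to take them in the whole space.\<close>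

lemma (in Metric_space) mtotally_bounded_centers_in_space:
  "mtotally_bounded S \<longleftrightarrow>
     S \<subseteq> M \<and> (\<forall>r>0. \<exists>K. finite K \<and> K \<subseteq> M \<and> S \<subseteq> (\<Union>x\<in>K. mball x r))"
proof (intro iffI conjI allI impI)
  assume L: "mtotally_bounded S"
  then show "S \<subseteq> M" by (rule mtotally_bounded_imp_subset)
  fix r :: real assume "r > 0"
  with L \<open>S \<subseteq> M\<close> show "\<exists>K. finite K \<and> K \<subseteq> M \<and> S \<subseteq> (\<Union>x\<in>K. mball x r)"
    unfolding mtotally_bounded_def by (meson order_trans)
next
  assume R: "S \<subseteq> M \<and> (\<forall>r>0. \<exists>K. finite K \<and> K \<subseteq> M \<and> S \<subseteq> (\<Union>x\<in>K. mball x r))"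
  show "mtotally_bounded S"
    unfolding mtotally_bounded_def
  proof (intro allI impI)
    fix e :: real assume "e > 0"
    then have "e / 2 > 0" by simp
    with R obtain K where K: "finite K" "K \<subseteq> M" "S \<subseteq> (\<Union>x\<in>K. mball x (e/2))" by meson
    define K' where "K' = {x \<in> K. mball x (e/2) \<inter> S \<noteq> {}}"
    define c where "c x = (SOME y. y \<in> mball x (e/2) \<inter> S)" for x
    have "c x \<in> mball x (e/2) \<inter> S" if "x \<in> K'" for x
      unfolding c_def by (rule someI_ex) (use that in \<open>auto simp: K'_def\<close>)
    then have c: "c x \<in> mball x (e/2)" "c x \<in> S" if "x \<in> K'" for x
      using that by blast+
    have "S \<subseteq> (\<Union>x\<in>c ` K'. mball x e)"
    proof
      fix y assume y: "y \<in> S"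
      with K obtain x where x: "x \<in> K" "y \<in> mball x (e/2)" by blast
      with y have x': "x \<in> K'" by (auto simp: K'_def)
      have "c x \<in> M" "x \<in> M" "y \<in> M" "d x (c x) < e/2" "d x y < e/2"
        using c(1)[OF x'] x(2) by auto
      moreover from this have "d (c x) y \<le> d (c x) x + d x y" by (intro triangle)
      ultimately have "y \<in> mball (c x) e" by (simp add: commute)
      then show "y \<in> (\<Union>x\<in>c ` K'. mball x e)" using x' by blast
    qed
    moreover have "finite (c ` K')" "c ` K' \<subseteq> S" using K(1) c(2) by (auto simp: K'_def)
    ultimately show "\<exists>K. finite K \<and> K \<subseteq> S \<and> S \<subseteq> (\<Union>x\<in>K. mball x e)" by blast
  qed
qed

definition isometric_spaces ::
  "'a set \<Rightarrow> ('a \<Rightarrow> 'a \<Rightarrow> real) \<Rightarrow> 'b set \<Rightarrow> ('b \<Rightarrow> 'b \<Rightarrow> real) \<Rightarrow> bool" where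
  "isometric_spaces X d Y \<rho> \<longleftrightarrow>
     (\<exists>f. bij_betw f X Y \<and> (\<forall>x\<in>X. \<forall>y\<in>X. \<rho> (f x) (f y) = d x y))"

definition is_completion_of ::
  "'b set \<Rightarrow> ('b \<Rightarrow> 'b \<Rightarrow> real) \<Rightarrow> 'a set \<Rightarrow> ('a \<Rightarrow> 'a \<Rightarrow> real) \<Rightarrow> bool" where
  "is_completion_of Y \<rho> X d \<longleftrightarrow>
     Ultrametric_space Y \<rho> \<and> Ultrametric_space X d \<and>
     Metric_space.mcomplete Y \<rho> \<and>
     (\<exists>S. S \<subseteq> Y \<and> Metric_space.mtopology Y \<rho> closure_of S = Y \<and> isometric_spaces X d S \<rho>)"


section \<open>Trees\<close>

text \<open>A graph is given by its vertex set and its set of edges, the edges being two-element sets of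
  vertices. Paths and cycles are given by their lists of pairwise distinct vertices.\<close>

definition simple_graph :: "'a set \<Rightarrow> 'a set set \<Rightarrow> bool" where
  "simple_graph V E \<longleftrightarrow> (\<forall>e\<in>E. \<exists>u\<in>V. \<exists>v\<in>V. u \<noteq> v \<and> e = {u, v})"

definition graph_path :: "'a set \<Rightarrow> 'a set set \<Rightarrow> 'a \<Rightarrow> 'a list \<Rightarrow> 'a \<Rightarrow> bool" where
  "graph_path V E u p v \<longleftrightarrow>
     p \<noteq> [] \<and> hd p = u \<and> last p = v \<and> set p \<subseteq> V \<and> distinct p \<and>
     successively (\<lambda>a b. {a, b} \<in> E) p"

definition graph_cycle :: "'a set \<Rightarrow> 'a set set \<Rightarrow> 'a list \<Rightarrow> bool" where
  "graph_cycle V E p \<longleftrightarrow>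
     3 \<le> length p \<and> set p \<subseteq> V \<and> distinct p \<and>
     (\<forall>i<length p. {p ! i, p ! (Suc i mod length p)} \<in> E)"

definition is_tree :: "'a set \<Rightarrow> 'a set set \<Rightarrow> bool" where
  "is_tree V E \<longleftrightarrow>
     V \<noteq> {} \<and> simple_graph V E \<and>
     (\<forall>u\<in>V. \<forall>v\<in>V. \<exists>p. graph_path V E u p v) \<and>
     (\<nexists>p. graph_cycle V E p)"

definition star_graph :: "'a set \<Rightarrow> 'a set set \<Rightarrow> bool" where
  "star_graph V E \<longleftrightarrow>
     is_tree V E \<and>
     (\<exists>c\<in>V. (\<forall>v\<in>V - {c}. {c, v} \<in> E) \<and> (\<forall>u\<in>V - {c}. \<forall>v\<in>V - {c}. {u, v} \<notin> E))"

text \<open>The ray \<open>(x 0, x 1, \<dots>)\<close>; that it is a tree is the lemma \<open>ray_is_tree\<close> below.\<close>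

definition ray :: "(nat \<Rightarrow> 'a) \<Rightarrow> 'a set \<Rightarrow> 'a set set \<Rightarrow> bool" where
  "ray x V E \<longleftrightarrow> inj x \<and> V = range x \<and> E = range (\<lambda>n. {x n, x (Suc n)})"

lemma ray_is_tree:
  assumes "ray x V E"
  shows "is_tree V E"
proof -
  have x: "inj x" and V: "V = range x" and E: "E = range (\<lambda>n. {x n, x (Suc n)})"
    using assms by (auto simp: ray_def)
  have adj: "{x m, x n} \<in> E \<longleftrightarrow> n = Suc m \<or> m = Suc n" for m n
    using x by (auto simp: E doubleton_eq_iff inj_eq)
  have up: "graph_path V E (x m) (map x [m..<Suc n]) (x n)" if "m \<le> n" for m n
    unfolding graph_path_def
  proof (intro conjI)
    have "[m..<Suc n] \<noteq> []" "hd [m..<Suc n] = m" "last [m..<Suc n] = n"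
      using that by (simp_all add: hd_upt del: upt_Suc)
    then show "map x [m..<Suc n] \<noteq> []" "hd (map x [m..<Suc n]) = x m" "last (map x [m..<Suc n]) = x n"
      by (simp_all add: hd_map last_map del: upt_Suc)
    show "set (map x [m..<Suc n]) \<subseteq> V" by (auto simp: V)
    show "distinct (map x [m..<Suc n])"
      using x by (simp add: distinct_map inj_on_subset[OF x subset_UNIV] del: upt_Suc)
    show "successively (\<lambda>a b. {a, b} \<in> E) (map x [m..<Suc n])"
      by (simp add: successively_conv_nth adj del: upt_Suc)
  qed
  have down: "graph_path V E v (rev p) u" if "graph_path V E u p v" for u p v
    using that by (auto simp: graph_path_def hd_rev last_rev insert_commute)
  have path: "\<exists>p. graph_path V E (x m) p (x n)" for m n
    using up[of m n] down[OF up[of n m]] by (cases "m \<le> n") auto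
  have nocycle: "\<not> graph_cycle V E p" for p
  proof
    assume p: "graph_cycle V E p"
    define k where "k = length p"
    define f where "f i = inv x (p ! i)" for i
    have k: "3 \<le> k" using p by (simp add: graph_cycle_def k_def)
    have pf: "p ! i = x (f i)" if "i < k" for i
      using that p nth_mem[of i p] unfolding f_def graph_cycle_def V k_def
      by (metis f_inv_into_f subsetD)
    have finj: "i = j" if "i < k" "j < k" "f i = f j" for i j
    proof -
      have "p ! i = p ! j" using that pf[of i] pf[of j] by simp
      then show ?thesis using that p nth_eq_iff_index_eq[of p i j] by (simp add: graph_cycle_def k_def)
    qed
    have step: "f (Suc i mod k) = Suc (f i) \<or> f i = Suc (f (Suc i mod k))" if "i < k" for i
    proof -
      have "Suc i mod k < k" using k by simp
      then show ?thesis
        using that p pf[of i] pf[of "Suc i mod k"] adj[of "f i" "f (Suc i mod k)"]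
        by (auto simp: graph_cycle_def k_def)
    qed
    have fin: "finite (f ` {..<k})" "f ` {..<k} \<noteq> {}" using k by (auto simp: lessThan_empty_iff)
    from Max_in[OF this] obtain i where i: "i < k" "f i = Max (f ` {..<k})" by force
    have mx: "f j \<le> f i" if "j < k" for j using that fin(1) by (simp add: i(2))
    define s where "s = Suc i mod k"
    define q where "q = (if i = 0 then k - 1 else i - 1)"
    have qk: "q < k" "Suc q mod k = i"
      using k i(1) by (cases i; simp add: q_def)+
    have sk: "s < k" using k by (simp add: s_def)
    have "f i = Suc (f s)" using step[OF i(1)] mx[OF sk] by (auto simp: s_def)
    moreover have "f i = Suc (f q)" using step[OF qk(1)] mx[OF qk(1)] by (auto simp: qk(2))
    ultimately have "s = q" using finj[OF sk qk(1)] by simp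
    then show False
      using k i(1) by (cases "Suc i = k"; cases "i = 0") (simp_all add: s_def q_def)
  qed
  have "simple_graph V E"
    unfolding simple_graph_def
  proof
    fix e assume "e \<in> E"
    then obtain n where "e = {x n, x (Suc n)}" by (auto simp: E)
    moreover have "x n \<noteq> x (Suc n)" using x by (simp add: inj_eq)
    ultimately show "\<exists>u\<in>V. \<exists>v\<in>V. u \<noteq> v \<and> e = {u, v}" unfolding V by blast
  qed
  with path nocycle show ?thesis by (auto simp: is_tree_def V)
qed


section \<open>Spaces generated by labeled trees\<close>

definition labeled_tree :: "'a set \<Rightarrow> 'a set set \<Rightarrow> ('a \<Rightarrow> real) \<Rightarrow> bool" where
  "labeled_tree V E l \<longleftrightarrow> is_tree V E \<and> (\<forall>v\<in>V. 0 \<le> l v)"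

text \<open>The description is proper for \<open>u, v \<in> V\<close> in a tree, where the path from \<open>u\<close> to \<open>v\<close> is
  unique.\<close>

definition tree_dist :: "'a set \<Rightarrow> 'a set set \<Rightarrow> ('a \<Rightarrow> real) \<Rightarrow> 'a \<Rightarrow> 'a \<Rightarrow> real" where
  "tree_dist V E l u v =
     (if u = v then 0 else Max (l ` set (THE p. graph_path V E u p v)))"

definition generated_by ::
  "'a set \<Rightarrow> ('a \<Rightarrow> 'a \<Rightarrow> real) \<Rightarrow> 'a set \<Rightarrow> 'a set set \<Rightarrow> ('a \<Rightarrow> real) \<Rightarrow> bool" where
  "generated_by X d V E l \<longleftrightarrow>
     labeled_tree V E l \<and> X = V \<and> (\<forall>u\<in>X. \<forall>v\<in>X. d u v = tree_dist V E l u v)"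

definition US_space :: "'a set \<Rightarrow> ('a \<Rightarrow> 'a \<Rightarrow> real) \<Rightarrow> bool" where
  "US_space X d \<longleftrightarrow>
     Ultrametric_space X d \<and> (\<exists>V E l. star_graph V E \<and> generated_by X d V E l)"

definition generated_by_decreasing_ray :: "'a set \<Rightarrow> ('a \<Rightarrow> 'a \<Rightarrow> real) \<Rightarrow> bool" where
  "generated_by_decreasing_ray X d \<longleftrightarrow>
     (\<exists>x V E l. ray x V E \<and> decseq (\<lambda>n. l (x n)) \<and> generated_by X d V E l)"

end

theory Submission
  imports Defs
begin

text \<open>
  In a space generated by a labeled star, distinct points are at distance the maximum of their
  labels and the label of the center \<open>c\<close>. Compactness of an infinite such space forces \<open>l c = 0\<close>,
  and then only finitely many labels exceed any given \<open>e > 0\<close>; listing the points other than \<open>c\<close> by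
  decreasing label gives the ray, because the maximum of a decreasing labeling over a path of the ray
  is attained at the endpoint of smaller index. Conversely, total boundedness forces the labels of a
  decreasing ray to tend to \<open>0\<close>, so the ray is a Cauchy sequence. A convergent sequence together with
  its limit is compact, hence the completion adds exactly one point \<open>c\<close>, and it is generated by the star
  with center \<open>c\<close> and labels \<open>d z c\<close>.
\<close>

lemma tree_dist_eqI:
  assumes "u \<noteq> v" and "graph_path V E u p v" and "\<And>q. graph_path V E u q v \<Longrightarrow> q = p"
  shows "tree_dist V E l u v = Max (l ` set p)"
proof -
  have "(THE q. graph_path V E u q v) = p" using assms(2,3) by (rule the_equality)
  then show ?thesis using assms(1) by (simp add: tree_dist_def)
qed


section \<open>Stars\<close>

text \<open>Every edge contains \<open>c\<close>, which a path visits only once. Two consecutive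
  edges must therefore meet in \<open>c\<close>, and a path with four or more vertices would have
  two disjoint edges through \<open>c\<close>.\<close>

lemma star_path_unique:
  assumes edges: "\<And>e. e \<in> E \<Longrightarrow> c \<in> e"
    and p: "graph_path V E u p v" and "u \<noteq> v"
  shows "p = (if u = c \<or> v = c then [u, v] else [u, c, v])"
proof -
  have p': "p \<noteq> []" "hd p = u" "last p = v" "distinct p" "successively (\<lambda>a b. {a, b} \<in> E) p"
    using p by (auto simp: graph_path_def)
  have edge: "a = c \<or> b = c" if "{a, b} \<in> E" for a b using edges[OF that] by auto
  consider a where "p = [a]" | a b where "p = [a, b]" | a b z where "p = [a, b, z]"
    | a b z w q where "p = a # b # z # w # q"
    using p'(1) by (metis list.exhaust)
  then show ?thesis
  proof cases
    case 1
    then show ?thesis using p' assms(3) by auto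
  next
    case 2
    then show ?thesis using p' edge[of u v] by auto
  next
    case 3
    then show ?thesis using p' edge[of a b] edge[of b z] by auto
  next
    case 4
    then show ?thesis using p' edge[of a b] edge[of b z] edge[of z w] by auto
  qed
qed

text \<open>The label \<open>l c\<close> enters the maximum in every case, because \<open>c\<close>
  is either an endpoint or the middle vertex of the path; so one formula suffices.\<close>

lemma star_tree_dist:
  assumes star: "\<And>v. v \<in> V - {c} \<Longrightarrow> {c, v} \<in> E" "\<And>e. e \<in> E \<Longrightarrow> c \<in> e"
    and V: "c \<in> V" "u \<in> V" "v \<in> V" "u \<noteq> v"
  shows "tree_dist V E l u v = max (l c) (max (l u) (l v))"
proof -
  define p where "p = (if u = c \<or> v = c then [u, v] else [u, c, v])"
  have "graph_path V E u p v"
    using V star(1)[of u] star(1)[of v]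
    by (auto simp: graph_path_def p_def insert_commute)
  then have "tree_dist V E l u v = Max (l ` set p)"
    using V(4) star_path_unique[OF star(2), where V = V] unfolding p_def by (intro tree_dist_eqI) blast+
  also have "\<dots> = max (l c) (max (l u) (l v))"
    by (auto simp: p_def max_def)
  finally show ?thesis .
qed

lemma star_graphE:
  assumes "star_graph V E"
  obtains c where "c \<in> V" "\<And>v. v \<in> V - {c} \<Longrightarrow> {c, v} \<in> E" "\<And>e. e \<in> E \<Longrightarrow> c \<in> e"
proof -
  obtain c where c: "c \<in> V" "\<forall>v\<in>V - {c}. {c, v} \<in> E" "\<forall>u\<in>V - {c}. \<forall>v\<in>V - {c}. {u, v} \<notin> E"
    using assms by (auto simp: star_graph_def)
  have "c \<in> e" if "e \<in> E" for e
  proof -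
    have "simple_graph V E" using assms by (simp add: star_graph_def is_tree_def)
    then obtain u v where "u \<in> V" "v \<in> V" "e = {u, v}"
      using \<open>e \<in> E\<close> unfolding simple_graph_def by blast
    then show ?thesis using c(3) that by blast
  qed
  with c that show ?thesis by blast
qed

lemma star_graph_spokes:
  assumes "c \<in> V"
  shows "star_graph V ((\<lambda>v. {c, v}) ` (V - {c}))" (is "star_graph V ?E")
proof -
  have edge: "{a, b} \<in> ?E \<longleftrightarrow> a \<in> V \<and> b \<in> V \<and> a \<noteq> b \<and> (a = c \<or> b = c)" for a b
    using assms by (auto simp: doubleton_eq_iff)
  have "simple_graph V ?E" unfolding simple_graph_def using assms by blast
  moreover have "\<exists>p. graph_path V ?E u p v" if "u \<in> V" "v \<in> V" for u v
  proof -
    have "graph_path V ?E u (if u = v then [u] else if u = c \<or> v = c then [u, v] else [u, c, v]) v"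
      using that assms by (auto simp: graph_path_def edge)
    then show ?thesis ..
  qed
  moreover have "\<not> graph_cycle V ?E p" for p
  proof
    assume p: "graph_cycle V ?E p"
    let ?k = "length p"
    have k: "3 \<le> ?k" and "distinct p"
      and cyc: "\<And>i. i < ?k \<Longrightarrow> p ! i = c \<or> p ! (Suc i mod ?k) = c"
      using p by (auto simp: graph_cycle_def edge)
    have ne: "p ! i \<noteq> p ! j" if "i < ?k" "j < ?k" "i \<noteq> j" for i j
      using that \<open>distinct p\<close> by (simp add: nth_eq_iff_index_eq)
    \<comment> \<open>The first two edges both contain \<open>c\<close>, and \<open>c\<close> cannot
      be at both positions 0 and 2, so it sits at position 1.\<close>
    have "p ! 0 = c \<or> p ! 1 = c" "p ! 1 = c \<or> p ! 2 = c"
      using cyc[of 0] cyc[of 1] k by (simp_all add: numeral_2_eq_2 flip: length_greater_0_conv)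
    moreover have "p ! 0 \<noteq> p ! 2" using k by (intro ne) auto
    ultimately have 1: "p ! 1 = c" by metis
    \<comment> \<open>The index after 2 wraps to 0 in a triangle and is 3 otherwise, never 1; so the
      edge leaving position 2 would have to avoid \<open>c\<close>.\<close>
    have s: "Suc 2 mod ?k < ?k" "Suc 2 mod ?k \<noteq> 1"
      using k by (cases "?k = 3"; simp)+
    have "p ! 2 = c \<or> p ! (Suc 2 mod ?k) = c" using cyc[of 2] k by auto
    moreover have "p ! 2 \<noteq> p ! 1" "p ! (Suc 2 mod ?k) \<noteq> p ! 1" 
      using ne[of 2 1] ne[of "Suc 2 mod ?k" 1] k s by linarith+
    ultimately show False using 1 by simp
  qed
  ultimately have "is_tree V ?E" using assms unfolding is_tree_def by blast
  moreover have "\<forall>v\<in>V - {c}. {c, v} \<in> ?E" "\<forall>u\<in>V - {c}. \<forall>v\<in>V - {c}. {u, v} \<notin> ?E"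
    using assms by (auto simp: edge)
  ultimately show ?thesis using assms unfolding star_graph_def by blast
qed


section \<open>Rays\<close>

text \<open>A repetition-free walk on the naturals with unit steps cannot turn round, since turning
  would revisit the vertex two steps back. Descending lists are described through \<open>rev\<close>
  because \<open>upt\<close> only ascends.\<close>

lemma distinct_unit_steps:
  fixes q :: "nat list"
  assumes "q \<noteq> []" "distinct q" "successively (\<lambda>a b. b = Suc a \<or> a = Suc b) q"
  shows "q = [hd q..<Suc (last q)] \<and> hd q \<le> last q \<or>
         rev q = [last q..<Suc (hd q)] \<and> last q \<le> hd q"
  using assms
proof (induction q)
  case (Cons a q)
  show ?case
  proof (cases q)
    case Nil
    then show ?thesis by simp
  next
    case (Cons b r)
    let ?z = "last q"
    have ab: "b = Suc a \<or> a = Suc b" and "a \<notin> set q" and last: "last (a # q) = ?z" and hd: "hd q = b"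
      using Cons.prems Cons by auto
    have "q = [b..<Suc ?z] \<and> b \<le> ?z \<or> rev q = [?z..<Suc b] \<and> ?z \<le> b"
      using Cons.IH Cons.prems Cons by auto
    then show ?thesis
    proof (elim disjE conjE)
      assume q: "q = [b..<Suc ?z]" and le: "b \<le> ?z"
      have "set q = {b..?z}" by (subst q) auto
      show ?thesis
      proof (cases "b = Suc a")
        case True
        then have "a # q = [a..<Suc ?z]"
          using q le upt_conv_Cons[of a "Suc ?z"] by simp
        then show ?thesis using True le unfolding last list.sel by simp
      next
        case False
        \<comment> \<open>A head on the other side of \<open>b\<close> would already lie in the
          interval \<open>set q\<close>, unless the tail is the single vertex
          \<open>b\<close>.\<close>
        then have a: "a = Suc b" using ab by simp
        then have "b = ?z" using \<open>a \<notin> set q\<close> \<open>set q = {b..?z}\<close> le by auto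
        then have "q = [b]" using q by simp
        then show ?thesis using a by simp
      qed
    next
      assume q: "rev q = [?z..<Suc b]" and le: "?z \<le> b"
      have "set q = {?z..b}" by (metis atLeastAtMost_upt q set_rev)
      show ?thesis
      proof (cases "a = Suc b")
        case True
        then have "rev (a # q) = [?z..<Suc a]" using q le by simp
        then show ?thesis using True le unfolding last list.sel by simp
      next
        case False
        then have a: "b = Suc a" using ab by simp
        then have "b = ?z" using \<open>a \<notin> set q\<close> \<open>set q = {?z..b}\<close> le by auto
        then have "rev q = [b]" unfolding q by simp
        then have "q = [b]" by (metis rev_singleton_conv)
        then show ?thesis using a by simp
      qed
    qed
  qed
qed simp

text \<open>The injection \<open>x\<close> turns a path into a list of indices with unit steps. This
  gives uniqueness; existence comes from \<open>ray_is_tree\<close>.\<close>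

lemma ray_path:
  assumes ray: "ray x V E" and p: "graph_path V E (x m) p (x n)"
  shows "p = (if m \<le> n then map x [m..<Suc n] else map x (rev [n..<Suc m]))"
proof -
  have x: "inj x" and V: "V = range x" and E: "E = range (\<lambda>n. {x n, x (Suc n)})"
    using ray by (auto simp: ray_def)
  have adj: "{x i, x j} \<in> E \<longleftrightarrow> j = Suc i \<or> i = Suc j" for i j
    using x by (auto simp: E doubleton_eq_iff inj_eq)
  have p': "p \<noteq> []" "hd p = x m" "last p = x n" "distinct p" "set p \<subseteq> range x"
    "successively (\<lambda>a b. {a, b} \<in> E) p"
    using p by (auto simp: graph_path_def V)
  obtain q where q: "p = map x q" using p'(5) by (metis ex_map_conv subsetD rangeE)
  then have ends: "q \<noteq> []" "hd q = m" "last q = n"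
    using p'(1-3) x by (auto simp: hd_map last_map inj_eq)
  have "distinct q" "successively (\<lambda>a b. b = Suc a \<or> a = Suc b) q"
    using p'(4,6) by (simp_all add: q distinct_map successively_map adj)
  from distinct_unit_steps[OF ends(1) this]
  have "q = [m..<Suc n] \<and> m \<le> n \<or> rev q = [n..<Suc m] \<and> n \<le> m" by (simp only: ends)
  then show ?thesis
  proof (elim disjE conjE)
    assume "q = [m..<Suc n]" "m \<le> n"
    then show ?thesis using q by simp
  next
    assume "rev q = [n..<Suc m]" "n \<le> m"
    then have "q = rev [n..<Suc m]" by (metis rev_rev_ident)
    then show ?thesis using q \<open>n \<le> m\<close> by (cases "m = n") (simp_all del: upt_Suc, simp)
  qed
qed

lemma decreasing_ray_tree_dist:
  assumes ray: "ray x V E" and dec: "decseq (\<lambda>n. l (x n))" and "m \<noteq> n"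
  shows "tree_dist V E l (x m) (x n) = l (x (min m n))"
proof -
  define p where "p = (if m \<le> n then map x [m..<Suc n] else map x (rev [n..<Suc m]))"
  have "x m \<in> V" "x n \<in> V" "x m \<noteq> x n" using ray \<open>m \<noteq> n\<close> by (auto simp: ray_def inj_eq)
  then obtain q where "graph_path V E (x m) q (x n)"
    using ray_is_tree[OF ray] unfolding is_tree_def by blast
  \<comment> \<open>Connectedness supplied some path \<open>q\<close>, and \<open>ray_path\<close>
    forces it to be \<open>p\<close>.\<close>
  then have "graph_path V E (x m) p (x n)" using ray_path[OF ray] by (simp only: p_def)
  then have "tree_dist V E l (x m) (x n) = Max (l ` set p)"
    using \<open>x m \<noteq> x n\<close> ray_path[OF ray] unfolding p_def by (intro tree_dist_eqI) blast+
  also have "set p = x ` {min m n..max m n}"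
    by (auto simp: p_def min_def max_def simp del: upt_Suc)
  also have "Max (l ` x ` {min m n..max m n}) = l (x (min m n))"
    using decseqD[OF dec] by (intro Max_eqI) auto
  finally show ?thesis .
qed


section \<open>Compact star spaces and completions of rays\<close>

text \<open>Centers may be taken in \<open>T\<close> itself; a ball of radius \<open>e\<close>
  around such a center contains no other point of \<open>T\<close>, so the finitely many centers are
  all of \<open>T\<close>. This is how total boundedness yields finiteness in both directions of the
  equivalence.\<close>

lemma (in Metric_space) finite_separated_subset:
  assumes "mtotally_bounded S" "T \<subseteq> S" "0 < e"
    and sep: "\<And>x y. \<lbrakk>x \<in> T; y \<in> T; x \<noteq> y\<rbrakk> \<Longrightarrow> e \<le> d x y"
  shows "finite T"
proof -
  have "mtotally_bounded T" using assms(1,2) by (rule mtotally_bounded_subset)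
  then obtain K where K: "finite K" "K \<subseteq> T" "T \<subseteq> (\<Union>x\<in>K. mball x e)"
    using \<open>0 < e\<close> unfolding mtotally_bounded_def by meson
  have "T \<subseteq> K"
  proof
    fix y assume "y \<in> T"
    then obtain x where "x \<in> K" "d x y < e" using K(3) by auto
    moreover from this have "x = y" using sep[of x y] \<open>y \<in> T\<close> K(2) by fastforce
    ultimately show "y \<in> K" by simp
  qed
  then show ?thesis using K(1) finite_subset by blast
qed

text \<open>Greedy choice: each step takes a point of largest \<open>f\<close>-value among those not
  yet listed. Finiteness of the superlevel sets makes this maximum exist and prevents any point from
  being postponed forever.\<close>

lemma decreasing_enumeration:
  fixes f :: "'a \<Rightarrow> real"
  assumes "infinite S" and fin: "\<And>v. v \<in> S \<Longrightarrow> finite {u \<in> S. f v \<le> f u}"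
  obtains x :: "nat \<Rightarrow> 'a" where "inj x" "range x = S" "decseq (\<lambda>n. f (x n))"
proof -
  have max: "\<exists>u. u \<in> S - T \<and> (\<forall>w\<in>S - T. f w \<le> f u)" if "finite T" for T
  proof -
    have "infinite (S - T)" using assms(1) that by simp
    then obtain v where v: "v \<in> S - T" by (metis ex_in_conv finite.emptyI)
    \<comment> \<open>The maximum over the infinite set \<open>S - T\<close> is attained in the
      finite nonempty part where \<open>f\<close> is at least \<open>f v\<close>.\<close>
    define U where "U = {u \<in> S - T. f v \<le> f u}"
    have U: "finite U" "U \<noteq> {}"
      using fin[of v] v by (auto simp: U_def elim: rev_finite_subset)
    have "Max (f ` U) \<in> f ` U" using U by simp
    then obtain u where u: "u \<in> U" "f u = Max (f ` U)" by (metis imageE)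
    have "f w \<le> f u" if "w \<in> S - T" for w
    proof (cases "f v \<le> f w")
      case True
      then show ?thesis using that U(1) by (simp add: u(2) U_def)
    next
      case False
      then show ?thesis using u(1) by (simp add: U_def)
    qed
    then show ?thesis using u(1) by (auto simp: U_def)
  qed
  define g where "g T = (SOME u. u \<in> S - T \<and> (\<forall>w\<in>S - T. f w \<le> f u))" for T
  have g: "g T \<in> S - T" "\<And>w. w \<in> S - T \<Longrightarrow> f w \<le> f (g T)" if "finite T" for T
    using someI_ex[OF max[OF that]] unfolding g_def by blast+
  \<comment> \<open>\<open>A n\<close> is the set of the first \<open>n\<close> chosen
    points.\<close>
  define A where "A = rec_nat {} (\<lambda>_ T. insert (g T) T)"
  have A: "A 0 = {}" "\<And>n. A (Suc n) = insert (g (A n)) (A n)" by (simp_all add: A_def)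
  define x where "x n = g (A n)" for n
  have Ax: "A n = x ` {..<n}" for n
    by (induction n) (simp_all add: A lessThan_Suc x_def)
  have finA: "finite (A n)" for n by (simp add: Ax)
  have x: "x n \<in> S" "x n \<notin> x ` {..<n}" "\<And>w. w \<in> S - x ` {..<n} \<Longrightarrow> f w \<le> f (x n)" for n
    using g[OF finA[of n]] unfolding x_def[symmetric] unfolding Ax by blast+
  have "x m \<noteq> x n" if "m < n" for m n using x(2)[of n] that by (metis imageI lessThan_iff)
  then have inj: "inj x" by (metis injI linorder_neqE_nat)
  \<comment> \<open>The next point was still available at stage \<open>n\<close>, when
    \<open>x n\<close> was chosen as a maximizer.\<close>
  have "x (Suc n) \<in> S - x ` {..<n}" for n
    using x(1,2)[of "Suc n"] by (simp add: lessThan_Suc)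
  then have dec: "decseq (\<lambda>n. f (x n))" using x(3) by (simp add: decseq_Suc_iff)
  have "v \<in> range x" if "v \<in> S" for v
  proof (rule ccontr)
    assume "v \<notin> range x"
    \<comment> \<open>A missed \<open>v\<close> stays a candidate at every stage, so every
      \<open>x n\<close> has value at least \<open>f v\<close>.\<close>
    then have "range x \<subseteq> {u \<in> S. f v \<le> f u}" using that x(1,3) by blast
    then have "finite (range x)" using fin[OF that] finite_subset by blast
    then show False using inj finite_imageD by blast
  qed
  then have "range x = S" using x(1) by blast
  with inj dec that show ?thesis by blast
qed

lemma (in Ultrametric_space) subspace_ultrametric:
  assumes "Y \<subseteq> X" "Y \<noteq> {}"
  shows "Ultrametric_space Y d"
  using assms nonneg commute zero ultra by unfold_locales (auto simp: subset_iff)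

section \<open>A compact star space as the completion of a ray\<close>

lemma (in Ultrametric_space) compact_US_space_imp_completion_of_ray:
  assumes "infinite X" "compact_space mtopology" "US_space X d"
  shows "\<exists>X0. X0 \<subset> X \<and> mtotally_bounded X0 \<and> generated_by_decreasing_ray X0 d \<and>
           is_completion_of X d X0 d"
proof -
  have complete: "mcomplete" and tb: "mtotally_bounded X"
    using assms(2) by (simp_all add: compact_space_eq_mcomplete_mtotally_bounded)
  obtain E l where star: "star_graph X E" and gen: "generated_by X d X E l"
    using assms(3) by (auto simp: US_space_def generated_by_def)
  from star obtain c where c: "c \<in> X" "\<And>v. v \<in> X - {c} \<Longrightarrow> {c, v} \<in> E" "\<And>e. e \<in> E \<Longrightarrow> c \<in> e"
    by (rule star_graphE) blast
  have l0: "0 \<le> l v" if "v \<in> X" for v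
    using gen that by (simp add: generated_by_def labeled_tree_def)
  have dist: "d u v = max (l c) (max (l u) (l v))" if "u \<in> X" "v \<in> X" "u \<noteq> v" for u v
    using gen that star_tree_dist[OF c(2,3,1)] by (simp add: generated_by_def)
  \<comment> \<open>A positive label at the center would bound all distances between distinct points
    from below, making the whole of \<open>X\<close> separated.\<close>
  have lc: "l c = 0"
  proof (rule ccontr)
    assume "l c \<noteq> 0"
    then have "0 < l c" using l0[OF c(1)] by simp
    with tb have "finite X" by (rule finite_separated_subset[OF _ subset_refl]) (simp add: dist)
    then show False using assms(1) by simp
  qed
  define X0 where "X0 = X - {c}"
  have X0: "X0 \<subset> X" "infinite X0" using c(1) assms(1) by (auto simp: X0_def)
  have dist0: "d u v = max (l u) (l v)" if "u \<in> X0" "v \<in> X0" "u \<noteq> v" for u v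
    using that dist[of u v] l0[of u] by (simp add: X0_def lc)
  have distc: "d c v = l v" if "v \<in> X0" for v
    using that dist[of c v] c(1) l0[of v] by (auto simp: X0_def lc)
  \<comment> \<open>The enumeration requires finite superlevel sets at each value
    \<open>l v\<close>, and \<open>fin\<close> provides them at positive levels.\<close>
  have pos: "0 < l v" if "v \<in> X0" for v
    using that distc[OF that] zero[of c v] c(1) nonneg[of c v] by (auto simp: X0_def)
  have fin: "finite {u \<in> X0. e \<le> l u}" if "0 < e" for e
    by (rule finite_separated_subset[OF tb _ that]) (use X0 in \<open>auto simp: dist0\<close>)
  obtain x where x: "inj x" "range x = X0" "decseq (\<lambda>n. l (x n))"
    using decreasing_enumeration[OF X0(2), of l] fin pos by metis
  define F where "F = range (\<lambda>n. {x n, x (Suc n)})"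
  have ray: "ray x X0 F" using x by (simp add: ray_def F_def)
  have "d u v = tree_dist X0 F l u v" if "u \<in> X0" "v \<in> X0" for u v
  proof (cases "u = v")
    case True
    then show ?thesis using zero[of u u] that X0(1) by (auto simp: tree_dist_def)
  next
    case False
    obtain m n where mn: "u = x m" "v = x n" using \<open>u \<in> X0\<close> \<open>v \<in> X0\<close> x(2) by blast
    then have "m \<noteq> n" using False by auto
    have "d u v = max (l (x m)) (l (x n))" using dist0[OF that False] by (simp add: mn)
    also have "\<dots> = l (x (min m n))"
      using decseqD[OF x(3), of m n] decseqD[OF x(3), of n m] by (cases "m \<le> n") auto
    also have "\<dots> = tree_dist X0 F l u v"
      using decreasing_ray_tree_dist[OF ray x(3) \<open>m \<noteq> n\<close>] by (simp add: mn)
    finally show ?thesis .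
  qed
  moreover have "labeled_tree X0 F l"
    using ray_is_tree[OF ray] l0 X0(1) by (auto simp: labeled_tree_def)
  ultimately have "generated_by_decreasing_ray X0 d"
    unfolding generated_by_decreasing_ray_def generated_by_def using ray x(3) by blast
  moreover have "is_completion_of X d X0 d"
  proof -
    have "\<exists>y\<in>X0. y \<in> mball z r" if "z \<in> X" "0 < r" for z r
    proof (cases "z = c")
      case True
      \<comment> \<open>The label of a point of \<open>X0\<close> is its distance to
        \<open>c\<close>, so a label below \<open>r\<close> puts the point into the ball around
        \<open>c\<close>.\<close>
      have "infinite (X0 - {u \<in> X0. r \<le> l u})" using fin[OF \<open>0 < r\<close>] X0(2) by simp
      then obtain y where "y \<in> X0" "l y < r"
        by (metis (no_types, lifting) Diff_iff ex_in_conv finite.emptyI mem_Collect_eq not_le)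
      then show ?thesis using distc[of y] X0(1) c(1) True by auto
    next
      case False
      then show ?thesis using that by (intro bexI[of _ z]) (simp_all add: X0_def)
    qed
    then have "mtopology closure_of X0 = X" by (auto simp: metric_closure_of)
    moreover have "isometric_spaces X0 d X0 d"
      unfolding isometric_spaces_def by (intro exI[of _ id]) simp
    moreover have "Ultrametric_space X0 d" using X0 by (intro subspace_ultrametric) auto
    ultimately show ?thesis
      using X0(1) complete Ultrametric_space_axioms unfolding is_completion_of_def by blast
  qed
  moreover have "mtotally_bounded X0" using tb X0(1) mtotally_bounded_subset by blast
  ultimately show ?thesis using X0(1) by blast
qed

section \<open>The completion of a ray as a compact star space\<close>

text \<open>With the labels \<open>d z c\<close> the center has label 0, and the larger of
  \<open>L m\<close> and \<open>L n\<close> is \<open>L (min m n)\<close> because \<open>L\<close>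
  is decreasing; hence the star formula reproduces \<open>d\<close>.\<close>

lemma (in Ultrametric_space) US_space_one_point_completion:
  fixes y :: "nat \<Rightarrow> 'a"
  assumes y: "inj y" "X = insert c (range y)" "\<And>n. d (y n) c = L n"
    and dist: "\<And>m n. m \<noteq> n \<Longrightarrow> d (y m) (y n) = L (min m n)" and "decseq L"
  shows "US_space X d"
proof -
  have c: "c \<in> X" by (simp add: y(2))
  define E where "E = (\<lambda>v. {c, v}) ` (X - {c})"
  have star: "star_graph X E" unfolding E_def using c by (rule star_graph_spokes)
  have cc: "d c c = 0" using zero c by simp
  have "d u v = tree_dist X E (\<lambda>z. d z c) u v" if "u \<in> X" "v \<in> X" for u v
  proof (cases "u = v")
    case True
    then show ?thesis using zero[of u u] that by (simp add: tree_dist_def)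
  next
    case False
    have "d u v = max (d u c) (d v c)"
    proof (cases "u = c \<or> v = c")
      case True
      then show ?thesis using nonneg commute cc by (auto simp: max_def antisym)
    next
      case False
      then obtain m n where mn: "u = y m" "v = y n" using \<open>u \<in> X\<close> \<open>v \<in> X\<close> y(2) by blast
      then have "m \<noteq> n" using \<open>u \<noteq> v\<close> by auto
      then show ?thesis
        using dist[of m n] decseqD[OF \<open>decseq L\<close>, of m n] decseqD[OF \<open>decseq L\<close>, of n m]
        by (cases "m \<le> n") (auto simp: mn y(3))
    qed
    also have "\<dots> = max (d c c) (max (d u c) (d v c))"
      using nonneg[of u c] by (simp add: cc max_def)
    also have "\<dots> = tree_dist X E (\<lambda>z. d z c) u v"
      by (rule star_tree_dist[symmetric]) (use that c False in \<open>auto simp: E_def\<close>)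
    finally show ?thesis .
  qed
  moreover have "labeled_tree X E (\<lambda>z. d z c)"
    using star nonneg by (auto simp: labeled_tree_def star_graph_def)
  ultimately have "generated_by X d X E (\<lambda>z. d z c)" by (simp add: generated_by_def)
  then show ?thesis unfolding US_space_def using star Ultrametric_space_axioms by blast
qed

lemma (in Ultrametric_space) completion_of_ray_imp_compact_US_space:
  assumes tb: "mtotally_bounded X0" and gen: "generated_by_decreasing_ray X0 d"
    and compl: "is_completion_of X d X0 d"
  shows "compact_space mtopology \<and> US_space X d"
proof -
  obtain x E l where ray: "ray x X0 E" and dec: "decseq (\<lambda>n. l (x n))"
    and gen': "generated_by X0 d X0 E l"
    using gen by (auto simp: generated_by_decreasing_ray_def generated_by_def)
  \<comment> \<open>Density is given for the isometric copy \<open>S\<close>, which may differ from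
    \<open>X0\<close>; so the Cauchy argument below runs on the images \<open>y n\<close> in
    \<open>S\<close>.\<close>
  obtain S f where S: "S \<subseteq> X" "mtopology closure_of S = X"
    and f: "bij_betw f X0 S" "\<And>u v. \<lbrakk>u \<in> X0; v \<in> X0\<rbrakk> \<Longrightarrow> d (f u) (f v) = d u v"
    and complete: "mcomplete"
    using compl unfolding is_completion_of_def isometric_spaces_def by blast
  have "X0 \<subseteq> X" using tb by (rule mtotally_bounded_imp_subset)
  have x: "inj x" "X0 = range x" using ray by (auto simp: ray_def)
  define L where "L n = l (x n)" for n
  have "decseq L" using dec by (simp add: L_def [abs_def])
  have distx: "d (x m) (x n) = L (min m n)" if "m \<noteq> n" for m n
    using gen' decreasing_ray_tree_dist[OF ray dec that] x(2) by (simp add: generated_by_def L_def)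
  have pos: "0 < L n" for n
  proof -
    have "L n = d (x n) (x (Suc n))" using distx[of n "Suc n"] by simp
    moreover have "x n \<noteq> x (Suc n)" using x(1) by (simp add: inj_eq)
    moreover have "x n \<in> X" "x (Suc n) \<in> X" using \<open>X0 \<subseteq> X\<close> x(2) by auto
    ultimately show ?thesis
      using zero[of "x n" "x (Suc n)"] nonneg[of "x n" "x (Suc n)"] by linarith
  qed
  have small: "\<exists>N. \<forall>n\<ge>N. L n < e" if "0 < e" for e
  proof -
    have "finite (x ` {n. e \<le> L n})"
    proof (rule finite_separated_subset[OF tb _ that])
      show "x ` {n. e \<le> L n} \<subseteq> X0" using x(2) by auto
      fix u v assume "u \<in> x ` {n. e \<le> L n}" "v \<in> x ` {n. e \<le> L n}" "u \<noteq> v"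
      then obtain m n where "u = x m" "v = x n" "e \<le> L m" "e \<le> L n" "m \<noteq> n" by blast
      then show "e \<le> d u v" using distx[of m n] by (simp add: min_def)
    qed
    then have "finite {n. e \<le> L n}" using x(1) by (simp add: finite_image_iff inj_on_def)
    then obtain N where "\<forall>n\<in>{n. e \<le> L n}. n < N" by (auto simp: finite_nat_set_iff_bounded)
    then have "\<forall>n\<ge>N. L n < e" by (metis mem_Collect_eq not_le)
    then show ?thesis ..
  qed
  define y where "y n = f (x n)" for n
  have S': "S = range y" using f(1) by (auto simp: bij_betw_def x(2) y_def)
  have yX: "y n \<in> X" for n using S(1) S' by auto
  have "inj y"
    using f(1) x(1) by (auto simp: bij_betw_def x(2) y_def inj_on_def)
  have disty: "d (y m) (y n) = L (min m n)" if "m \<noteq> n" for m n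
    using f(2)[of "x m" "x n"] distx[OF that] by (simp add: y_def x(2))
  have "MCauchy y"
    unfolding MCauchy_def
  proof (intro conjI allI impI)
    show "range y \<subseteq> X" using yX by blast
    fix e :: real assume "0 < e"
    from small[OF this] obtain N where N: "\<forall>n\<ge>N. L n < e" ..
    have "d (y m) (y n) < e" if "N \<le> m" "N \<le> n" for m n
      using disty[of m n] N that zero[of "y n" "y n"] yX \<open>0 < e\<close> by (cases "m = n") auto
    then show "\<exists>N. \<forall>n n'. N \<le> n \<longrightarrow> N \<le> n' \<longrightarrow> d (y n) (y n') < e" by blast
  qed
  then obtain c where lim: "limitin mtopology y c sequentially"
    using complete unfolding mcomplete_def by blast
  then have "c \<in> X" by (simp add: limitin_metric)
  \<comment> \<open>Ultrametric triangles are isosceles: for large \<open>m\<close> the point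
    \<open>y m\<close> is closer to \<open>c\<close> than \<open>L n\<close>, so \<open>y n\<close>
    is as far from \<open>c\<close> as from \<open>y m\<close>.\<close>
  have distc: "d (y n) c = L n" for n
  proof -
    have "eventually (\<lambda>m. y m \<in> X \<and> d (y m) c < L n) sequentially"
      using lim pos[of n] by (simp add: limitin_metric)
    then obtain N where N: "\<forall>m\<ge>N. d (y m) c < L n" by (auto simp: eventually_sequentially)
    \<comment> \<open>\<open>Suc n\<close> ensures \<open>n < m\<close>, so that
      \<open>min n m\<close> is \<open>n\<close>.\<close>
    define m where "m = max N (Suc n)"
    have m: "d (y m) c < L n" "d (y n) (y m) = L n"
      using N disty[of n m] by (auto simp: m_def min_def)
    have "d (y n) c \<le> max (d (y n) (y m)) (d (y m) c)" "d (y n) (y m) \<le> max (d (y n) c) (d c (y m))"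
      using yX \<open>c \<in> X\<close> by (auto intro!: ultra)
    then show ?thesis using m commute[of c "y m"] by auto
  qed
  have compact: "compactin mtopology (insert c S)"
    using lim S' S(1) by (intro compactin_sequence_with_limit) auto
  \<comment> \<open>Compact sets in a Hausdorff space are closed, so \<open>insert c S\<close>
    contains the closure of \<open>S\<close>, which is \<open>X\<close>.\<close>
  then have "closedin mtopology (insert c S)"
    using Hausdorff_space_mtopology by (rule compactin_imp_closedin[rotated])
  then have "X \<subseteq> insert c S"
    using closure_of_minimal[of S "insert c S" mtopology] S(2) by blast
  then have X: "X = insert c (range y)" using S(1) S' \<open>c \<in> X\<close> by blast
  have "compact_space mtopology" using compact by (simp add: compact_space_def S' flip: X)
  moreover have "US_space X d"
    using \<open>inj y\<close> X distc disty \<open>decseq L\<close> by (rule US_space_one_point_completion)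
  ultimately show ?thesis ..
qed

theorem theorem5p6:
  fixes X :: "'a set" and d :: "'a \<Rightarrow> 'a \<Rightarrow> real"
  assumes "Ultrametric_space X d" and "infinite X"
  shows "(compact_space (Metric_space.mtopology X d) \<and> US_space X d) \<longleftrightarrow>
         (\<exists>X0. X0 \<subset> X \<and>
               Metric_space.mtotally_bounded X d X0 \<and>
               generated_by_decreasing_ray X0 d \<and>
               is_completion_of X d X0 d)"
proof -
  interpret Ultrametric_space X d by (rule assms(1))
  show ?thesis
    using compact_US_space_imp_completion_of_ray[OF assms(2)] completion_of_ray_imp_compact_US_space
    by blast
qed

end
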